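(* Let $\mathscr{C}=(S,V_1,V_2,\Pi_1,\Pi_2,\langle\ ,\ \rangle)$ be a Coxeter datum with Coxeter parameters $m_{st}$ ($s,t\in S$), let $(W,R)$ be the abstract Coxeter system with these parameters, $R=\{r_s\mid s\in S\}$, and let $f_1\colon W\to W_1(\mathscr{C})$ and $f_2\colon W\to W_2(\mathscr{C})$ be the group homomorphisms satisfying $f_1(r_s)=\rho_{V_1}(s)$ and $f_2(r_s)=\rho_{V_2}(s)$ for all $s\in S$. Then $f_1$ and $f_2$ are isomorphisms; that is, $(W_1(\mathscr{C}),R_1(\mathscr{C}))$ and $(W_2(\mathscr{C}),R_2(\mathscr{C}))$ are both Coxeter systems isomorphic to $(W,R)$.
   Context: **Coxeter datum.** Let $S$ be an arbitrary set in which each unordered pair $\{s,t\}$ of elements is assigned an $m_{st}\in\mathbb{Z}\cup\{\infty\}$ with $m_{ss}=1$ for all $s\in S$ and $m_{st}\ge 2$ for all distinct $s,t\in S$. For a subset $A$ of a real vector space, $\mathrm{PLC}(A)=\{\sum_{a\in A}\lambda_a a\mid \lambda_a\ge 0 \text{ for all } a\in A, \text{ and } \lambda_{a'}>0\text{ for some }a'\in A\}$ (finite sums). A Coxeter datum with Coxeter parameters $m_{st}$ is a tuple $\mathscr{C}=(S,V_1,V_2,\Pi_1,\Pi_2,\langle\ ,\ \rangle)$ where $V_1,V_2$ are real vector spaces, $\langle\ ,\ \rangle\colon V_1\times V_2\to\mathbb{R}$ is bilinear, $\Pi_1=\{\alpha_s\mid s\in S\}\subseteq V_1$ and $\Pi_2=\{\beta_s\mid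 s\in S\}\subseteq V_2$, such that: (C1) $\langle\alpha_s,\beta_s\rangle=1$ for all $s\in S$; (C2) $\langle\alpha_s,\beta_t\rangle\le 0$ for all distinct $s,t\in S$; (C3) for all $s,t\in S$, $\langle\alpha_s,\beta_t\rangle\langle\alpha_t,\beta_s\rangle=\cos^2(\pi/m_{st})$ if $m_{st}\ne\infty$, and equals $\gamma^2$ for some $\gamma\ge1$ (depending on $s,t$) if $m_{st}=\infty$; (C4) $\langle\alpha_s,\beta_t\rangle=0$ if and only if $\langle\alpha_t,\beta_s\rangle=0$, for all $s,t\in S$; (C5) $\sum_{s\in S}\lambda_s\alpha_s=0$ with all $\lambda_s\ge0$ implies all $\lambda_s=0$, and $\sum_{s\in S}\lambda_s\beta_s=0$ with all $\lambda_s\ge0$ implies all $\lambda_s=0$ (i.e. $0\notin\mathrm{PLC}(\Pi_1)$ and $0\notin\mathrm{PLC}(\Pi_2)$). Linear independence of $\Pi_1,\Pi_2$ is not assumed. **Reflections.** For $s\in S$ define $\rho_{V_1}(s)(x)=x-2\langle x,\beta_s\rangle\alpha_s$ for $x\in V_1$ and $\rho_{V_2}(s)(y)=y-2\langle\alpha_s,y\rangle\beta_s$ for $y\in V_2$. For $i\in\{1,2\}$ let $R_i(\mathscr{C})=\{\rho_{V_i}(s)\mid s\in S\}$ and let $W_i(\mathscr{C})$ be the subgroup of $\mathrm{GL}(V_i)$ generated by $R_i(\mathscr{C})$. **Abstract Coxeter system.** $(W,R)$ is the Coxeter system where $R=\{r_s\mid s\in S\}$ is a set of involutions generating $W$ subject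 only to the condition that the product $r_sr_t$ has order $m_{st}$ whenever $m_{st}\ne\infty$. The homomorphisms $f_1,f_2$ exist because $\rho_{V_i}(s)\rho_{V_i}(t)$ has order $m_{st}$ in $\mathrm{GL}(V_i)$. *)

theory Defs
  imports Complex_Main "HOL-Library.Extended_Nat" "HOL-Analysis.Linear_Algebra"
    "HOL-Algebra.Elementary_Groups"
begin

section \<open>Coxeter systems\<close>

locale coxeter_parameters =
  fixes S :: "'s set" and m :: "'s \<Rightarrow> 's \<Rightarrow> enat"
  assumes m_sym: "\<lbrakk>s \<in> S; t \<in> S\<rbrakk> \<Longrightarrow> m s t = m t s"
    and m_diag: "s \<in> S \<Longrightarrow> m s s = 1"
    and m_off_diag: "\<lbrakk>s \<in> S; t \<in> S; s \<noteq> t\<rbrakk> \<Longrightarrow> 2 \<le> m s t"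

text \<open>
  The congruence on words over \<open>S\<close> generated by \<open>(st)\<^bsup>m s t\<^esup> \<sim> 1\<close> for finite \<open>m s t\<close>.
  The case \<open>s = t\<close> is \<open>ss \<sim> 1\<close>, so every generator is its own inverse. Hence words without
  formal inverses suffice, and the quotient monoid is the presented group.
\<close>

inductive coxeter_cong :: "'s set \<Rightarrow> ('s \<Rightarrow> 's \<Rightarrow> enat) \<Rightarrow> 's list \<Rightarrow> 's list \<Rightarrow> bool"
  for S m where
  rel: "\<lbrakk>s \<in> S; t \<in> S; m s t = enat k; u \<in> lists S; v \<in> lists S\<rbrakk>
    \<Longrightarrow> coxeter_cong S m (u @ concat (replicate k [s, t]) @ v) (u @ v)"
| refl: "u \<in> lists S \<Longrightarrow> coxeter_cong S m u u"
| sym: "coxeter_cong S m u v \<Longrightarrow> coxeter_cong S m v u"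
| trans: "\<lbrakk>coxeter_cong S m u v; coxeter_cong S m v w\<rbrakk> \<Longrightarrow> coxeter_cong S m u w"

definition word_prod :: "('g, 'b) monoid_scheme \<Rightarrow> ('s \<Rightarrow> 'g) \<Rightarrow> 's list \<Rightarrow> 'g" where
  "word_prod G r u = foldr (\<lambda>s g. r s \<otimes>\<^bsub>G\<^esub> g) u \<one>\<^bsub>G\<^esub>"

text \<open>
  The group \<open>G\<close> with the generators \<open>r s\<close> has the presentation
  \<open>\<langle>S | (st)\<^bsup>m s t\<^esup> = 1 whenever m s t \<noteq> \<infinity>\<rangle>\<close>: the \<open>r s\<close> generate \<open>G\<close>, and two words have
  equal values exactly if the defining relations force this.
\<close>

definition coxeter_system ::
    "('g, 'b) monoid_scheme \<Rightarrow> 's set \<Rightarrow> ('s \<Rightarrow> 's \<Rightarrow> enat) \<Rightarrow> ('s \<Rightarrow> 'g) \<Rightarrow> bool" where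
  "coxeter_system G S m r \<longleftrightarrow>
     coxeter_parameters S m \<and> group G \<and> r ` S \<subseteq> carrier G \<and>
     generate G (r ` S) = carrier G \<and>
     (\<forall>u \<in> lists S. \<forall>v \<in> lists S. word_prod G r u = word_prod G r v \<longleftrightarrow> coxeter_cong S m u v)"

definition coxeter_isomorphic ::
    "('g, 'b) monoid_scheme \<Rightarrow> 'g set \<Rightarrow> ('h, 'c) monoid_scheme \<Rightarrow> 'h set \<Rightarrow> bool" where
  "coxeter_isomorphic G R H R' \<longleftrightarrow> (\<exists>g \<in> iso G H. g ` R = R')"


section \<open>Coxeter data and their reflection groups\<close>

text \<open>The sums in \<open>C5\<close> are over finitely supported families.\<close>

locale coxeter_datum = coxeter_parameters S m
  for S :: "'s set" and m :: "'s \<Rightarrow> 's \<Rightarrow> enat" +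
  fixes B :: "'v::real_vector \<Rightarrow> 'w::real_vector \<Rightarrow> real"
    and \<alpha> :: "'s \<Rightarrow> 'v" and \<beta> :: "'s \<Rightarrow> 'w"
  assumes bilinear: "bilinear B"
    and C1: "s \<in> S \<Longrightarrow> B (\<alpha> s) (\<beta> s) = 1"
    and C2: "\<lbrakk>s \<in> S; t \<in> S; s \<noteq> t\<rbrakk> \<Longrightarrow> B (\<alpha> s) (\<beta> t) \<le> 0"
    and C3_finite: "\<lbrakk>s \<in> S; t \<in> S; m s t = enat k\<rbrakk>
      \<Longrightarrow> B (\<alpha> s) (\<beta> t) * B (\<alpha> t) (\<beta> s) = (cos (pi / real k))\<^sup>2"
    and C3_infinite: "\<lbrakk>s \<in> S; t \<in> S; m s t = \<infinity>\<rbrakk>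
      \<Longrightarrow> \<exists>\<gamma>\<ge>1. B (\<alpha> s) (\<beta> t) * B (\<alpha> t) (\<beta> s) = \<gamma>\<^sup>2"
    and C4: "\<lbrakk>s \<in> S; t \<in> S\<rbrakk> \<Longrightarrow> B (\<alpha> s) (\<beta> t) = 0 \<longleftrightarrow> B (\<alpha> t) (\<beta> s) = 0"
    and C5_1: "\<lbrakk>finite {s \<in> S. c s \<noteq> 0}; \<forall>s\<in>S. 0 \<le> c s;
      (\<Sum>s \<in> {s \<in> S. c s \<noteq> 0}. c s *\<^sub>R \<alpha> s) = 0\<rbrakk> \<Longrightarrow> \<forall>s\<in>S. c s = 0"
    and C5_2: "\<lbrakk>finite {s \<in> S. c s \<noteq> 0}; \<forall>s\<in>S. 0 \<le> c s;
      (\<Sum>s \<in> {s \<in> S. c s \<noteq> 0}. c s *\<^sub>R \<beta> s) = 0\<rbrakk> \<Longrightarrow> \<forall>s\<in>S. c s = 0"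

definition GL :: "('v::real_vector \<Rightarrow> 'v) monoid" where
  "GL = \<lparr>carrier = {f. linear f \<and> bij f}, mult = (\<circ>), one = id\<rparr>"

definition \<rho>1 ::
    "('v::real_vector \<Rightarrow> 'w::real_vector \<Rightarrow> real) \<Rightarrow> ('s \<Rightarrow> 'v) \<Rightarrow> ('s \<Rightarrow> 'w) \<Rightarrow> 's \<Rightarrow> 'v \<Rightarrow> 'v" where
  "\<rho>1 B \<alpha> \<beta> s = (\<lambda>x. x - (2 * B x (\<beta> s)) *\<^sub>R \<alpha> s)"

definition \<rho>2 ::
    "('v::real_vector \<Rightarrow> 'w::real_vector \<Rightarrow> real) \<Rightarrow> ('s \<Rightarrow> 'v) \<Rightarrow> ('s \<Rightarrow> 'w) \<Rightarrow> 's \<Rightarrow> 'w \<Rightarrow> 'w" where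
  "\<rho>2 B \<alpha> \<beta> s = (\<lambda>y. y - (2 * B (\<alpha> s) y) *\<^sub>R \<beta> s)"

definition W1 :: "'s set \<Rightarrow> ('v::real_vector \<Rightarrow> 'w::real_vector \<Rightarrow> real) \<Rightarrow> ('s \<Rightarrow> 'v) \<Rightarrow> ('s \<Rightarrow> 'w)
    \<Rightarrow> ('v \<Rightarrow> 'v) monoid" where
  "W1 S B \<alpha> \<beta> = subgroup_generated GL (\<rho>1 B \<alpha> \<beta> ` S)"

definition W2 :: "'s set \<Rightarrow> ('v::real_vector \<Rightarrow> 'w::real_vector \<Rightarrow> real) \<Rightarrow> ('s \<Rightarrow> 'v) \<Rightarrow> ('s \<Rightarrow> 'w)
    \<Rightarrow> ('w \<Rightarrow> 'w) monoid" where
  "W2 S B \<alpha> \<beta> = subgroup_generated GL (\<rho>2 B \<alpha> \<beta> ` S)"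

end

theory Submission
  imports Defs
begin

text \<open>
  Only faithfulness is deep: a word over \<open>S\<close> that acts trivially on \<open>V\<^sub>1\<close> must be trivial in the
  presented group. The rest is bookkeeping: two groups with generators indexed by \<open>S\<close> that realise
  the same presentation are isomorphic by exactly one map matching the generators, and the statement
  for \<open>V\<^sub>2\<close> is the statement for \<open>V\<^sub>1\<close> applied to the datum with the two spaces exchanged.

  Faithfulness rests on positivity. Let \<open>root_cone\<close> be the set of nonnegative combinations of the
  \<open>\<alpha> s\<close>. If \<open>u\<close> is a reduced word and appending \<open>s\<close> does not produce a shorter element, then \<open>u\<close> maps
  \<open>\<alpha> s\<close> into the cone (\<open>act_root_positive\<close>). Suppose now that an element other than the identity acts
  trivially, and write it as a reduced word \<open>w @ [s]\<close>. Then \<open>w\<close> sends \<open>\<alpha> s\<close> into the cone, while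
  \<open>\<alpha> s = w (s (\<alpha> s)) = - w (\<alpha> s)\<close>. Hence \<open>- \<alpha> s\<close> is in the cone, and adding \<open>\<alpha> s\<close> gives a nontrivial
  nonnegative combination of roots equal to zero, against \<open>C5\<close>.

  Positivity is proved by induction on the length of \<open>u\<close>, by reduction to rank two. Let \<open>t\<close> be the
  last letter of \<open>u\<close>. Among all factorisations of \<open>u\<close> as \<open>p @ q\<close> of the same total length with \<open>q\<close> a
  word in \<open>s\<close> and \<open>t\<close>, take one with \<open>p\<close> as short as possible. Minimality makes \<open>p\<close> shortest in its
  coset of the dihedral subgroup, so the induction hypothesis puts \<open>p (\<alpha> s)\<close> and \<open>p (\<alpha> t)\<close> into the
  cone. Since \<open>u\<close> is reduced and \<open>u @ [s]\<close> is no shorter, \<open>q\<close> alternates, does not end in \<open>s\<close>, and has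
  fewer than \<open>m s t\<close> letters. For such \<open>q\<close> the coefficients of \<open>q (\<alpha> s)\<close> in \<open>\<alpha> s\<close> and \<open>\<alpha> t\<close> are
  Chebyshev numbers (\<open>act_alternating\<close>), which are nonnegative in this range; the same formula at
  length \<open>2 m s t\<close>, for finite \<open>m s t\<close>, gives the defining relations (\<open>act_braid_identity\<close>).
\<close>


section \<open>Presentations by involutions\<close>

lemma word_prod_simps [simp]:
  "word_prod G r [] = \<one>\<^bsub>G\<^esub>"
  "word_prod G r (s # u) = r s \<otimes>\<^bsub>G\<^esub> word_prod G r u"
  by (simp_all add: word_prod_def)

lemma (in group) word_prod_closed:
  assumes "r ` S \<subseteq> carrier G" "u \<in> lists S"
  shows "word_prod G r u \<in> carrier G"
  using assms(2) assms(1) by (induction u) auto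

lemma (in group) word_prod_append:
  assumes "r ` S \<subseteq> carrier G" "u \<in> lists S" "v \<in> lists S"
  shows "word_prod G r (u @ v) = word_prod G r u \<otimes> word_prod G r v"
  using assms(2)
proof (induction u)
  case Nil
  then show ?case by (simp add: word_prod_closed[OF assms(1,3)])
next
  case (Cons s u)
  moreover have "r s \<in> carrier G" using Cons assms(1) by auto
  ultimately show ?case
    using word_prod_closed[OF assms(1)] assms(3) by (auto simp: m_assoc)
qed

lemma word_prod_hom:
  assumes "group G" "group H" "f \<in> hom G H" "r ` S \<subseteq> carrier G"
    and "\<forall>s\<in>S. f (r s) = r' s" "u \<in> lists S"
  shows "f (word_prod G r u) = word_prod H r' u"
  using assms(6)
proof (induction u)
  case Nil
  show ?case using hom_one[OF assms(3,1,2)] by simp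
next
  case (Cons s u)
  then have "r s \<in> carrier G" using assms(4) by auto
  with Cons show ?case
    using hom_mult[OF assms(3)] group.word_prod_closed[OF assms(1,4)] assms(5) by auto
qed

context coxeter_parameters
begin

abbreviation word_equiv (infix "\<approx>" 50) where "u \<approx> v \<equiv> coxeter_cong S m u v"

lemma word_equiv_in_lists:
  assumes "u \<approx> v"
  shows "u \<in> lists S" "v \<in> lists S"
proof -
  have "u \<in> lists S \<and> v \<in> lists S"
    using assms
  proof (induction rule: coxeter_cong.induct)
    case (rel s t k u v)
    have "concat (replicate k [s, t]) \<in> lists S"
      using rel(1,2) by (induction k) auto
    with rel show ?case by auto
  qed auto
  then show "u \<in> lists S" "v \<in> lists S" by auto
qed

lemma word_equiv_append:
  assumes "u \<approx> v" "x \<in> lists S" "y \<in> lists S"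
  shows "x @ u @ y \<approx> x @ v @ y"
  using assms(1)
proof (induction rule: coxeter_cong.induct)
  case (rel s t k u v)
  then show ?case
    using coxeter_cong.rel[of s S t m k "x @ u" "v @ y"] assms(2,3) by auto
next
  case (refl u)
  then show ?case using assms(2,3) by (auto intro!: coxeter_cong.refl)
next
  case (sym u v)
  show ?case using sym.IH by (rule coxeter_cong.sym)
next
  case (trans u v w)
  show ?case using trans.IH by (rule coxeter_cong.trans)
qed

lemmas word_equiv_appendL = word_equiv_append[where y = "[]", simplified]
lemmas word_equiv_appendR = word_equiv_append[where x = "[]", simplified]

lemma word_equiv_square:
  assumes "s \<in> S" "u \<in> lists S" "v \<in> lists S"
  shows "u @ s # s # v \<approx> u @ v"
  using coxeter_cong.rel[of s S s m 1 u v] assms m_diag[of s] by (simp add: one_enat_def)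

lemma word_equiv_rev_cancel:
  assumes "u \<in> lists S"
  shows "u @ rev u \<approx> []" "rev u @ u \<approx> []"
proof -
  have *: "u @ rev u \<approx> []" if "u \<in> lists S" for u
    using that
  proof (induction u rule: rev_induct)
    case Nil
    then show ?case by (auto intro: coxeter_cong.refl)
  next
    case (snoc s u)
    then have "u @ s # s # rev u \<approx> u @ rev u" by (intro word_equiv_square) auto
    with snoc show ?case by (auto intro: coxeter_cong.trans)
  qed
  show "u @ rev u \<approx> []" using * assms .
  have "rev u \<in> lists S" using assms by auto
  from *[OF this] show "rev u @ u \<approx> []" by simp
qed

lemma word_equiv_if_quotient_trivial:
  assumes "u \<in> lists S" "v \<in> lists S" "u @ rev v \<approx> []"
  shows "u \<approx> v"
proof -
  have "u @ rev v @ v \<approx> u"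
    using word_equiv_appendL[OF word_equiv_rev_cancel(2)[OF assms(2)] assms(1)] by simp
  moreover have "u @ rev v @ v \<approx> v"
    using word_equiv_appendR[OF assms(3,2)] by simp
  ultimately show ?thesis by (blast intro: coxeter_cong.sym coxeter_cong.trans)
qed

end

lemma coxeter_systemD:
  assumes "coxeter_system G S m r"
  shows "coxeter_parameters S m" "group G" "r ` S \<subseteq> carrier G" "generate G (r ` S) = carrier G"
    and "\<And>u v. \<lbrakk>u \<in> lists S; v \<in> lists S\<rbrakk>
      \<Longrightarrow> word_prod G r u = word_prod G r v \<longleftrightarrow> coxeter_cong S m u v"
  using assms unfolding coxeter_system_def by blast+

text \<open>
  Every generator is an involution, so inverses in the generated subgroup are again values of words.
\<close>

lemma coxeter_system_word_surj:
  assumes "coxeter_system G S m r" "g \<in> carrier G"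
  shows "\<exists>u\<in>lists S. word_prod G r u = g"
proof -
  note D = coxeter_systemD[OF assms(1)]
  interpret coxeter_parameters S m by (rule D)
  interpret group G by (rule D)
  have "g \<in> generate G (r ` S)" using D(4) assms(2) by simp
  then show ?thesis
  proof (induction rule: generate.induct)
    case one
    show ?case by (rule bexI[of _ "[]"]) auto
  next
    case (incl h)
    then obtain s where "s \<in> S" "h = r s" by auto
    then show ?case using D(3) by (intro bexI[of _ "[s]"]) auto
  next
    case (inv h)
    then obtain s where s: "s \<in> S" "h = r s" by auto
    then have rs: "r s \<in> carrier G" using D(3) by auto
    have "[s, s] \<approx> []" using word_equiv_square[of s "[]" "[]"] s by simp
    then have "word_prod G r [s, s] = word_prod G r []" using s by (subst D(5)) auto
    then have "r s \<otimes>\<^bsub>G\<^esub> r s = \<one>\<^bsub>G\<^esub>" using rs by simp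
    then have "inv\<^bsub>G\<^esub> h = r s" using rs s inv_equality by blast
    then show ?case using s rs by (intro bexI[of _ "[s]"]) auto
  next
    case (eng h1 h2)
    then show ?case using word_prod_append[OF D(3)] by (metis append_in_lists_conv)
  qed
qed

text \<open>
  Elements of both groups are values of words, and equality of values is the same congruence on
  both sides, so a map that respects generators is bijective.
\<close>

lemma coxeter_system_hom_iso:
  assumes "coxeter_system G S m r" "coxeter_system H S m r'"
    and "f \<in> hom G H" "\<forall>s\<in>S. f (r s) = r' s"
  shows "f \<in> iso G H"
proof -
  note G = coxeter_systemD[OF assms(1)] and H = coxeter_systemD[OF assms(2)]
  note f = word_prod_hom[OF G(2) H(2) assms(3) G(3) assms(4)]
  have "inj_on f (carrier G)"
  proof (rule inj_onI)
    fix g h assume "g \<in> carrier G" "h \<in> carrier G" and eq: "f g = f h"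
    then obtain u v where uv: "u \<in> lists S" "v \<in> lists S" "g = word_prod G r u" "h = word_prod G r v"
      using coxeter_system_word_surj[OF assms(1)] by metis
    then show "g = h" using eq f G(5) H(5) by metis
  qed
  moreover have "f ` carrier G = carrier H"
  proof
    show "f ` carrier G \<subseteq> carrier H" using hom_carrier[OF assms(3)] .
    show "carrier H \<subseteq> f ` carrier G"
      using coxeter_system_word_surj[OF assms(2)] f group.word_prod_closed[OF G(2,3)]
      by (metis image_eqI subsetI)
  qed
  ultimately show ?thesis
    using assms(3) by (simp add: iso_def bij_betw_def)
qed

lemma coxeter_system_hom_exists:
  assumes "coxeter_system G S m r" "coxeter_system H S m r'"
  shows "\<exists>f\<in>hom G H. \<forall>s\<in>S. f (r s) = r' s"
proof -
  note G = coxeter_systemD[OF assms(1)] and H = coxeter_systemD[OF assms(2)]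
  \<comment> \<open>The image of an element is read off from any word for it; the congruence makes the choice immaterial.\<close>
  obtain w where w: "\<And>g. g \<in> carrier G \<Longrightarrow> w g \<in> lists S \<and> word_prod G r (w g) = g"
    using coxeter_system_word_surj[OF assms(1)] by metis
  define f where "f g = word_prod H r' (w g)" for g
  have f: "f (word_prod G r u) = word_prod H r' u" if "u \<in> lists S" for u
    unfolding f_def using w[OF group.word_prod_closed[OF G(2,3) that]] that G(5) H(5) by blast
  have "f \<in> hom G H"
  proof (rule homI)
    fix x assume "x \<in> carrier G"
    then show "f x \<in> carrier H"
      using w group.word_prod_closed[OF H(2,3)] by (simp add: f_def)
  next
    fix x y assume "x \<in> carrier G" "y \<in> carrier G"
    then have xy: "w x \<in> lists S" "w y \<in> lists S"
      and "word_prod G r (w x) = x" "word_prod G r (w y) = y" using w by auto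
    then have "x \<otimes>\<^bsub>G\<^esub> y = word_prod G r (w x @ w y)"
      using group.word_prod_append[OF G(2,3) xy] by simp
    then have "f (x \<otimes>\<^bsub>G\<^esub> y) = word_prod H r' (w x @ w y)"
      using f[of "w x @ w y"] xy by simp
    also have "\<dots> = f x \<otimes>\<^bsub>H\<^esub> f y"
      using group.word_prod_append[OF H(2,3) xy] by (simp add: f_def)
    finally show "f (x \<otimes>\<^bsub>G\<^esub> y) = f x \<otimes>\<^bsub>H\<^esub> f y" .
  qed
  moreover have "f (r s) = r' s" if "s \<in> S" for s
  proof -
    have "r s \<in> carrier G" "r' s \<in> carrier H" using that G(3) H(3) by auto
    then show ?thesis
      using f[of "[s]"] that group.is_monoid[OF G(2)] group.is_monoid[OF H(2)]
      by (simp add: monoid.r_one)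
  qed
  ultimately show ?thesis by blast
qed


section \<open>Alternating words\<close>

text \<open>
  The last letter is the one acting first, and it is \<open>t\<close>: the words below are applied to \<open>\<alpha> s\<close>, and
  a final \<open>s\<close> would only change the sign.
\<close>

fun alternating :: "'s \<Rightarrow> 's \<Rightarrow> nat \<Rightarrow> 's list" where
  "alternating s t 0 = []"
| "alternating s t (Suc n) = alternating t s n @ [t]"

lemma length_alternating [simp]: "length (alternating s t n) = n"
  by (induction n arbitrary: s t) auto

lemma alternating_in_lists: "s \<in> S \<Longrightarrow> t \<in> S \<Longrightarrow> alternating s t n \<in> lists S"
  by (induction n arbitrary: s t) auto

lemma alternating_Suc_front:
  "alternating s t (Suc n) = (if even n then t else s) # alternating s t n"
proof (induction n arbitrary: s t)
  case (Suc n)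
  have "alternating s t (Suc (Suc n)) = alternating t s (Suc n) @ [t]" by simp
  also have "\<dots> = ((if even n then s else t) # alternating t s n) @ [t]"
    by (subst Suc.IH) simp
  finally show ?case by simp
qed simp

lemma alternating_add:
  "alternating s t (i + n) = (if even n then alternating s t i else alternating t s i) @ alternating s t n"
  by (induction n arbitrary: s t) auto

lemma concat_replicate_eq_alternating:
  "concat (replicate k [s, t]) = alternating s t (2 * k)"
proof (induction k)
  case (Suc k)
  have "alternating s t (2 * Suc k) = alternating s t (Suc (Suc (2 * k)))" by simp
  also have "\<dots> = s # t # alternating s t (2 * k)"
    by (simp only: alternating_Suc_front) simp
  finally show ?case using Suc by simp
qed simp

lemma alternating_double:
  "alternating s t (2 * n) = rev (alternating t s n) @ alternating s t n"
proof (induction n arbitrary: s t)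
  case (Suc n)
  have "alternating s t (2 * Suc n) = alternating s t (Suc (Suc (2 * n)))" by simp
  also have "\<dots> = s # alternating s t (Suc (2 * n))"
    by (subst alternating_Suc_front) simp
  also have "\<dots> = s # (rev (alternating s t n) @ alternating t s n) @ [t]"
    using Suc by simp
  finally show ?case by simp
qed simp

lemma eq_alternating:
  assumes "q \<in> lists {s, t}" "s \<noteq> t"
    and "\<And>x y a. q \<noteq> x @ a # a # y" "\<And>x. q \<noteq> x @ [s]"
  shows "q = alternating s t (length q)"
  using assms
proof (induction q arbitrary: s t rule: rev_induct)
  case (snoc a q)
  from snoc.prems have a: "a = t" by auto
  have "q = alternating t s (length q)"
  proof (rule snoc.IH)
    show "q \<in> lists {t, s}" using snoc.prems by auto
    show "t \<noteq> s" using snoc.prems by auto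
    show "q \<noteq> x @ b # b # y" for x y b using snoc.prems(3)[of x b "y @ [a]"] by auto
    show "q \<noteq> x @ [t]" for x using snoc.prems(3)[of x t "[]"] a by auto
  qed
  then show ?case using a by simp
qed simp

text \<open>
  The relation \<open>(st)\<^sup>k \<approx> []\<close> splits in the middle, the first half being the inverse of the alternating
  word with the roles of \<open>s\<close> and \<open>t\<close> exchanged.
\<close>

lemma (in coxeter_parameters) braid_relation:
  assumes "s \<in> S" "t \<in> S" "m s t = enat k"
  shows "alternating s t k \<approx> alternating t s k"
proof -
  have L: "alternating s t k \<in> lists S" "alternating t s k \<in> lists S"
    using assms alternating_in_lists by metis+
  have "rev (alternating t s k) @ alternating s t k \<approx> []"
    using coxeter_cong.rel[of s S t m k "[]" "[]"] assms
    by (simp add: concat_replicate_eq_alternating alternating_double)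
  then have "alternating t s k @ rev (alternating t s k) @ alternating s t k \<approx> alternating t s k"
    using word_equiv_appendL L(2) by fastforce
  moreover have "alternating t s k @ rev (alternating t s k) @ alternating s t k \<approx> alternating s t k"
    using word_equiv_appendR[OF word_equiv_rev_cancel(1)[OF L(2)] L(1)] by simp
  ultimately show ?thesis by (blast intro: coxeter_cong.sym coxeter_cong.trans)
qed


section \<open>Chebyshev numbers\<close>

text \<open>The value at \<open>x\<close> of the Chebyshev polynomial of the second kind of degree \<open>n - 1\<close>,
  extended by 0 to degree \<open>-1\<close>.\<close>

fun cheb :: "real \<Rightarrow> nat \<Rightarrow> real" where
  "cheb x 0 = 0"
| "cheb x (Suc 0) = 1"
| "cheb x (Suc (Suc n)) = 2 * x * cheb x (Suc n) - cheb x n"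

text \<open>
  The recurrence is that of \<open>sin (n \<theta>)\<close>, which gives the sign and the periodicity for finite \<open>m s t\<close>.
\<close>

lemma cheb_cos: "cheb (cos \<theta>) n * sin \<theta> = sin (real n * \<theta>)"
proof (induction "cos \<theta>" n rule: cheb.induct)
  case (3 n)
  have "sin (real (Suc (Suc n)) * \<theta>) + sin (real n * \<theta>) = 2 * cos \<theta> * sin (real (Suc n) * \<theta>)"
  proof -
    have "real (Suc (Suc n)) * \<theta> = real (Suc n) * \<theta> + \<theta>" "real n * \<theta> = real (Suc n) * \<theta> - \<theta>"
      by (simp_all add: algebra_simps)
    then show ?thesis by (simp only: sin_add sin_diff) simp
  qed
  with 3 show ?case by (simp add: algebra_simps)
qed auto

lemma cheb_cos_nonneg:
  assumes "2 \<le> k" "n \<le> k"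
  shows "0 \<le> cheb (cos (pi / real k)) n"
proof -
  have s: "0 < sin (pi / real k)" using assms by (intro sin_gt_zero) (auto simp: field_simps)
  have "0 \<le> sin (real n * (pi / real k))"
    using assms by (intro sin_ge_zero) (auto simp: field_simps)
  then show ?thesis
    using cheb_cos[of "pi / real k" n] s by (metis zero_le_mult_iff not_less)
qed

lemma cheb_cos_periodic:
  assumes "2 \<le> k"
  shows "cheb (cos (pi / real k)) (2 * k) = 0" "cheb (cos (pi / real k)) (Suc (2 * k)) = 1"
    "cheb (cos (pi / real k)) (2 * k - 1) = - 1"
proof -
  define \<theta> where "\<theta> = pi / real k"
  have s: "0 < sin \<theta>" using assms unfolding \<theta>_def by (intro sin_gt_zero) (auto simp: field_simps)
  have k: "real (2 * k) * \<theta> = 2 * pi" using assms by (simp add: \<theta>_def)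
  have "cheb (cos \<theta>) (2 * k) * sin \<theta> = 0" using k by (subst cheb_cos) (simp only: sin_two_pi)
  moreover have "cheb (cos \<theta>) (Suc (2 * k)) * sin \<theta> = sin \<theta>"
  proof -
    have "real (Suc (2 * k)) * \<theta> = \<theta> + 2 * pi" using k by (simp add: algebra_simps)
    then show ?thesis by (subst cheb_cos) (simp only: sin_periodic)
  qed
  moreover have "cheb (cos \<theta>) (2 * k - 1) * sin \<theta> = - sin \<theta>"
  proof -
    have "real (2 * k - 1) * \<theta> = - \<theta> + 2 * pi" using k assms by (simp add: algebra_simps of_nat_diff)
    then show ?thesis by (subst cheb_cos) (simp only: sin_periodic sin_minus)
  qed
  ultimately show "cheb (cos (pi / real k)) (2 * k) = 0" "cheb (cos (pi / real k)) (Suc (2 * k)) = 1"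
    "cheb (cos (pi / real k)) (2 * k - 1) = - 1"
    using s mult_right_cancel[of "sin \<theta>" _ 1] mult_right_cancel[of "sin \<theta>" _ "- 1"]
    unfolding \<theta>_def[symmetric] by simp_all
qed

text \<open>
  By the recurrence each increment is the previous one plus \<open>2 (x - 1)\<close> times a term, so terms and
  increments stay nonnegative together.
\<close>

lemma cheb_nonneg_ge_1:
  assumes "1 \<le> x"
  shows "0 \<le> cheb x n"
proof -
  have "0 \<le> cheb x n \<and> cheb x n \<le> cheb x (Suc n)"
  proof (induction n)
    case (Suc n)
    then have "1 * cheb x (Suc n) \<le> x * cheb x (Suc n)"
      using assms by (intro mult_right_mono) auto
    with Suc show ?case by auto
  qed simp
  then show ?thesis by simp
qed


section \<open>The reflection representation\<close>

context coxeter_datum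
begin

abbreviation reflection where "reflection \<equiv> \<rho>1 B \<alpha> \<beta>"

abbreviation act :: "'s list \<Rightarrow> 'v \<Rightarrow> 'v" where "act u \<equiv> foldr reflection u"

lemma linear_left: "linear (\<lambda>x. B x y)"
  using bilinear by (simp add: bilinear_def)

lemmas B_simps = linear_add[OF linear_left] linear_diff[OF linear_left]
  linear_scale[OF linear_left] linear_0[OF linear_left] linear_neg[OF linear_left]

lemma linear_reflection: "linear (reflection s)"
  by (rule linearI) (auto simp: \<rho>1_def B_simps algebra_simps)

lemma linear_act: "linear (act u)"
proof (induction u)
  case Nil
  show ?case by (simp add: linear_id id_def[symmetric])
next
  case (Cons s u)
  then show ?case using linear_compose[OF Cons linear_reflection[of s]] by (simp add: o_def)
qed

lemma reflection_root: "s \<in> S \<Longrightarrow> reflection s (\<alpha> s) = - \<alpha> s"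
  by (simp add: \<rho>1_def C1 algebra_simps scaleR_2)

lemma reflection_involution: "s \<in> S \<Longrightarrow> reflection s (reflection s x) = x"
  by (simp add: \<rho>1_def C1 B_simps algebra_simps)

text \<open>
  The two pairings may differ, but after rescaling \<open>\<alpha> t\<close> by \<open>\<kappa>\<close> both become \<open>- x\<close>, with \<open>x\<^sup>2\<close> the
  product prescribed by \<open>C3\<close>. Thus \<open>\<kappa>\<close> measures the asymmetry of the form, and the geometry of the
  pair depends on \<open>x\<close> alone.
\<close>

lemma rank_two_parameters:
  assumes "s \<in> S" "t \<in> S" "s \<noteq> t"
  obtains x \<kappa> where "0 < \<kappa>" "B (\<alpha> s) (\<beta> t) = - (\<kappa> * x)" "B (\<alpha> t) (\<beta> s) = - (x / \<kappa>)"
    "\<And>k. m s t = enat k \<Longrightarrow> x = cos (pi / real k)" "m s t = \<infinity> \<Longrightarrow> 1 \<le> x"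
proof -
  define a b where "a = - B (\<alpha> s) (\<beta> t)" and "b = - B (\<alpha> t) (\<beta> s)"
  have ab: "0 \<le> a" "0 \<le> b" "a = 0 \<longleftrightarrow> b = 0"
    using C2[of s t] C2[of t s] C4[of s t] assms by (auto simp: a_def b_def)
  define x where "x = sqrt (a * b)"
  have x2: "x * x = a * b" using ab by (simp add: x_def)
  have x0: "0 \<le> x" using ab by (simp add: x_def)
  \<comment> \<open>By \<open>C4\<close> the pairings vanish together; then \<open>x = 0\<close> and any positive scale will do.\<close>
  define \<kappa> where "\<kappa> = (if a = 0 then 1 else a / x)"
  have "0 < \<kappa>" using ab x2 x0 by (auto simp: \<kappa>_def x_def)
  moreover have "B (\<alpha> s) (\<beta> t) = - (\<kappa> * x)" "B (\<alpha> t) (\<beta> s) = - (x / \<kappa>)"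
    using ab x2 x0 by (auto simp: \<kappa>_def a_def[symmetric] b_def[symmetric] x_def)
      (auto simp: a_def b_def)
  moreover have "x = cos (pi / real k)" if k: "m s t = enat k" for k
  proof -
    have k2: "2 \<le> k" using m_off_diag[OF assms] k by (simp add: numeral_eq_enat)
    have "0 \<le> cos (pi / real k)" 
    proof (rule cos_ge_zero)
      have "0 \<le> pi / real k" by simp
      then show "- (pi / 2) \<le> pi / real k" using pi_ge_zero by linarith
      show "pi / real k \<le> pi / 2" using k2 by (intro divide_left_mono) auto
    qed
    moreover have "a * b = (cos (pi / real k))\<^sup>2" using C3_finite[OF assms(1,2) k] by (simp add: a_def b_def)
    ultimately show ?thesis by (simp add: x_def)
  qed
  moreover have "1 \<le> x" if "m s t = \<infinity>"
    using C3_infinite[OF assms(1,2) that] by (auto simp: x_def a_def b_def)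
  ultimately show ?thesis by (rule that)
qed

text \<open>
  Each reflection changes only its own coefficient, and in terms of \<open>\<alpha> s\<close> and \<open>\<kappa> \<alpha> t\<close> the new
  coefficient is \<open>2 x\<close> times the other one minus the old one. This is the Chebyshev recurrence.
\<close>

lemma act_alternating:
  assumes "s \<in> S" "t \<in> S" "\<kappa> \<noteq> 0" "B (\<alpha> s) (\<beta> t) = - (\<kappa> * x)" "B (\<alpha> t) (\<beta> s) = - (x / \<kappa>)"
  shows "act (alternating s t n) (\<alpha> s) =
    (if even n then cheb x (Suc n) *\<^sub>R \<alpha> s + (\<kappa> * cheb x n) *\<^sub>R \<alpha> t
     else cheb x n *\<^sub>R \<alpha> s + (\<kappa> * cheb x (Suc n)) *\<^sub>R \<alpha> t)"
proof (induction n)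
  case 0
  show ?case by simp
next
  case (Suc n)
  have B: "reflection s (\<alpha> s) = - \<alpha> s" "reflection t (\<alpha> t) = - \<alpha> t"
    "reflection s (\<alpha> t) = \<alpha> t + (2 * x / \<kappa>) *\<^sub>R \<alpha> s"
    "reflection t (\<alpha> s) = \<alpha> s + (2 * x * \<kappa>) *\<^sub>R \<alpha> t"
    using assms reflection_root by (auto simp: \<rho>1_def mult_ac)
  note lin = linear_add[OF linear_reflection] linear_scale[OF linear_reflection]
  have "act (alternating s t (Suc n)) (\<alpha> s)
      = reflection (if even n then t else s) (act (alternating s t n) (\<alpha> s))"
    by (simp add: alternating_Suc_front del: alternating.simps)
  also have "\<dots> = (if even (Suc n) then cheb x (Suc (Suc n)) *\<^sub>R \<alpha> s + (\<kappa> * cheb x (Suc n)) *\<^sub>R \<alpha> t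
     else cheb x (Suc n) *\<^sub>R \<alpha> s + (\<kappa> * cheb x (Suc (Suc n))) *\<^sub>R \<alpha> t)"
    using assms(3) by (simp add: Suc lin B algebra_simps)
  finally show ?case .
qed

text \<open>
  For distinct \<open>s\<close> and \<open>t\<close> with \<open>m s t\<close> finite, \<open>1 - x\<^sup>2 = sin\<^sup>2 (\<pi> / k)\<close> is nonzero, so the pairing is
  nondegenerate on the two roots and every vector is a combination of them plus a vector orthogonal
  to \<open>\<beta> s\<close> and \<open>\<beta> t\<close>. The latter is fixed by both reflections, and on the two roots the product is
  the identity by periodicity of the Chebyshev numbers.
\<close>

lemma act_braid_identity:
  assumes "s \<in> S" "t \<in> S" "m s t = enat k"
  shows "act (alternating s t (2 * k)) v = v"
proof (cases "s = t")
  case True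
  then have "k = 1" using m_diag assms by (simp add: one_enat_def)
  then show ?thesis using True assms by (simp add: reflection_involution numeral_2_eq_2)
next
  case False
  have k2: "2 \<le> k" using m_off_diag[OF assms(1,2) False] assms(3) by (simp add: numeral_eq_enat)
  obtain x \<kappa> where \<kappa>: "0 < \<kappa>" "B (\<alpha> s) (\<beta> t) = - (\<kappa> * x)" "B (\<alpha> t) (\<beta> s) = - (x / \<kappa>)"
    and x: "x = cos (pi / real k)"
    using rank_two_parameters[OF assms(1,2) False] assms(3) by metis
  note cheb = cheb_cos_periodic[OF k2, folded x]
  obtain k' where "k = Suc k'" using k2 by (cases k) auto
  then obtain j where j: "2 * k = Suc j" "odd j" by simp
  have s: "act (alternating s t (2 * k)) (\<alpha> s) = \<alpha> s"
    by (subst act_alternating[OF assms(1,2) _ \<kappa>(2,3)]) (use \<kappa>(1) cheb in auto)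
  \<comment> \<open>The last reflection negates \<open>\<alpha> t\<close>; the remaining word has the roles of the two roots exchanged and scale \<open>1 / \<kappa>\<close>.\<close>
  have "act (alternating t s j) (\<alpha> t) = - \<alpha> t"
    using act_alternating[of t s "1 / \<kappa>" x j] assms \<kappa> j cheb by (auto simp: field_simps)
  then have t: "act (alternating s t (2 * k)) (\<alpha> t) = \<alpha> t"
    using j assms by (simp add: reflection_root linear_neg[OF linear_act])
  have fixed: "act (alternating s t n) z = z" if "B z (\<beta> s) = 0" "B z (\<beta> t) = 0" for z n
    by (induction n) (auto simp: alternating_Suc_front \<rho>1_def that simp del: alternating.simps(2))
  have det: "1 - x * x \<noteq> 0"
  proof -
    have "0 < sin (pi / real k)" using k2 by (intro sin_gt_zero) (auto simp: field_simps)
    then show ?thesis using sin_squared_eq[of "pi / real k"] by (auto simp: x power2_eq_square)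
  qed
  define p q where "p = B v (\<beta> s)" and "q = B v (\<beta> t)"
  \<comment> \<open>Cramer's rule for the coefficients of the component in the plane of the two roots.\<close>
  define c d where "c = (p + q * x / \<kappa>) / (1 - x * x)" and "d = (q + p * \<kappa> * x) / (1 - x * x)"
  define z where "z = v - c *\<^sub>R \<alpha> s - d *\<^sub>R \<alpha> t"
  have cd: "c - d * x / \<kappa> = p" "d - c * \<kappa> * x = q"
    using det \<kappa>(1) by (simp_all add: c_def d_def divide_simps) algebra+
  have "B z (\<beta> s) = p - (c - d * x / \<kappa>)" "B z (\<beta> t) = q - (d - c * \<kappa> * x)"
    using assms by (simp_all add: z_def B_simps C1 \<kappa>(2,3) p_def[symmetric] q_def[symmetric])
  then have "B z (\<beta> s) = 0" "B z (\<beta> t) = 0"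
    unfolding cd by simp_all
  then have "act (alternating s t (2 * k)) (z + c *\<^sub>R \<alpha> s + d *\<^sub>R \<alpha> t) = z + c *\<^sub>R \<alpha> s + d *\<^sub>R \<alpha> t"
    by (simp only: linear_add[OF linear_act] linear_scale[OF linear_act] s t fixed)
  then show ?thesis by (simp add: z_def)
qed

lemma act_respects_word_equiv:
  assumes "u \<approx> v"
  shows "act u = act v"
  using assms
proof (induction rule: coxeter_cong.induct)
  case (rel s t k u v)
  then show ?case by (auto simp: concat_replicate_eq_alternating act_braid_identity)
qed auto


section \<open>The cone of nonnegative combinations of roots\<close>

inductive_set root_cone :: "'v set" where
  zero: "0 \<in> root_cone"
| add_root: "\<lbrakk>x \<in> root_cone; s \<in> S; 0 \<le> c\<rbrakk> \<Longrightarrow> x + c *\<^sub>R \<alpha> s \<in> root_cone"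

lemma root_cone_add: "y \<in> root_cone \<Longrightarrow> x \<in> root_cone \<Longrightarrow> x + y \<in> root_cone"
  by (induction rule: root_cone.induct) (auto simp: add.assoc[symmetric] intro: root_cone.intros)

lemma root_cone_scale: "x \<in> root_cone \<Longrightarrow> 0 \<le> c \<Longrightarrow> c *\<^sub>R x \<in> root_cone"
  by (induction rule: root_cone.induct) (auto simp: scaleR_add_right intro: root_cone.intros)

lemma root_in_cone: "s \<in> S \<Longrightarrow> \<alpha> s \<in> root_cone"
  using add_root[OF zero, of s 1] by simp

lemma root_cone_representation:
  assumes "x \<in> root_cone"
  shows "\<exists>F c. finite F \<and> F \<subseteq> S \<and> (\<forall>s. 0 \<le> c s) \<and> (\<forall>s. s \<notin> F \<longrightarrow> c s = 0)
    \<and> x = (\<Sum>s\<in>F. c s *\<^sub>R \<alpha> s)"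
  using assms
proof (induction rule: root_cone.induct)
  case zero
  show ?case by (rule exI[of _ "{}"], rule exI[of _ "\<lambda>_. 0"]) auto
next
  case (add_root x s d)
  then obtain F c where F: "finite F" "F \<subseteq> S" "\<forall>s. 0 \<le> c s" "\<forall>s. s \<notin> F \<longrightarrow> c s = 0"
    "x = (\<Sum>s\<in>F. c s *\<^sub>R \<alpha> s)" by blast
  have "x = (\<Sum>t\<in>insert s F. c t *\<^sub>R \<alpha> t)"
    unfolding F(5) using F(1,4) by (intro sum.mono_neutral_left) auto
  moreover have "d *\<^sub>R \<alpha> s = (\<Sum>t\<in>insert s F. (if t = s then d else 0) *\<^sub>R \<alpha> t)"
    using F(1) by (subst sum.remove[of _ s]) (auto intro!: sum.neutral[symmetric])
  ultimately have "x + d *\<^sub>R \<alpha> s = (\<Sum>t\<in>insert s F. (c t + (if t = s then d else 0)) *\<^sub>R \<alpha> t)"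
    by (simp add: scaleR_add_left sum.distrib)
  then show ?case using F add_root
    by (intro exI[of _ "insert s F"] exI[of _ "\<lambda>t. c t + (if t = s then d else 0)"]) auto
qed

text \<open>
  Otherwise adding \<open>\<alpha> s\<close> gives a vanishing nonnegative combination in which \<open>\<alpha> s\<close> has coefficient at
  least 1.
\<close>

lemma minus_root_notin_cone:
  assumes "s \<in> S"
  shows "- \<alpha> s \<notin> root_cone"
proof
  assume "- \<alpha> s \<in> root_cone"
  then obtain F c where F: "finite F" "F \<subseteq> S" "\<forall>s. 0 \<le> c s" "\<forall>s. s \<notin> F \<longrightarrow> c s = 0"
    "- \<alpha> s = (\<Sum>s\<in>F. c s *\<^sub>R \<alpha> s)" using root_cone_representation by meson
  define d where "d t = c t + (if t = s then 1 else 0)" for t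
  have "(\<Sum>t\<in>insert s F. d t *\<^sub>R \<alpha> t)
      = (\<Sum>t\<in>insert s F. c t *\<^sub>R \<alpha> t) + (\<Sum>t\<in>insert s F. (if t = s then 1 else 0) *\<^sub>R \<alpha> t)"
    by (simp add: d_def scaleR_add_left sum.distrib)
  also have "(\<Sum>t\<in>insert s F. c t *\<^sub>R \<alpha> t) = - \<alpha> s"
    unfolding F(5) using F(1,4) by (intro sum.mono_neutral_right) auto
  also have "(\<Sum>t\<in>insert s F. (if t = s then 1 else 0) *\<^sub>R \<alpha> t) = \<alpha> s"
    using F(1) by (subst sum.remove[of _ s]) (auto intro!: sum.neutral)
  finally have "(\<Sum>t\<in>insert s F. d t *\<^sub>R \<alpha> t) = 0" by simp
  moreover have supp: "{t \<in> S. d t \<noteq> 0} \<subseteq> insert s F" using F(4) by (auto simp: d_def split: if_splits)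
  moreover have "(\<Sum>t\<in>{t \<in> S. d t \<noteq> 0}. d t *\<^sub>R \<alpha> t) = (\<Sum>t\<in>insert s F. d t *\<^sub>R \<alpha> t)"
    using F(1,2) supp assms by (intro sum.mono_neutral_left) auto
  ultimately have "(\<Sum>t\<in>{t \<in> S. d t \<noteq> 0}. d t *\<^sub>R \<alpha> t) = 0" by simp
  moreover have "finite {t \<in> S. d t \<noteq> 0}" using supp F(1) finite_subset by blast
  moreover have "\<forall>t\<in>S. 0 \<le> d t" using F(3) by (auto simp: d_def)
  ultimately have "d s = 0" using C5_1 assms by blast
  moreover have "0 \<le> c s" using F(3) by blast
  ultimately show False by (simp add: d_def)
qed


section \<open>Reduced words act positively\<close>

definition reduced :: "'s list \<Rightarrow> bool" where
  "reduced u \<longleftrightarrow> u \<in> lists S \<and> (\<forall>v. u \<approx> v \<longrightarrow> length u \<le> length v)"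

lemma reducedD:
  assumes "reduced u"
  shows "u \<in> lists S" "u \<approx> v \<Longrightarrow> length u \<le> length v"
  using assms by (simp_all add: reduced_def del: in_lists_conv_set)

lemma reduced_if_equiv:
  assumes "reduced u" "u \<approx> v" "length v \<le> length u"
  shows "reduced v"
  unfolding reduced_def
proof (intro conjI allI impI)
  show "v \<in> lists S" using word_equiv_in_lists(2) assms(2) .
  show "length v \<le> length w" if "v \<approx> w" for w
    using reducedD(2)[OF assms(1) coxeter_cong.trans[OF assms(2) that]] assms(3) by simp
qed

lemma reduced_exists:
  assumes "u \<in> lists S"
  obtains v where "u \<approx> v" "reduced v"
proof -
  obtain v where v: "u \<approx> v" "\<And>w. u \<approx> w \<Longrightarrow> length v \<le> length w"
    using ex_has_least_nat[of "\<lambda>v. u \<approx> v" u length] coxeter_cong.refl[OF assms] by blast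
  have "reduced v"
    unfolding reduced_def using v word_equiv_in_lists(2)[OF v(1)] coxeter_cong.trans[OF v(1)] by blast
  with v(1) show ?thesis using that by blast
qed

lemma reduced_prefix:
  assumes "reduced (u @ v)"
  shows "reduced u"
  unfolding reduced_def
proof (intro conjI allI impI)
  show "u \<in> lists S" using assms by (auto simp: reduced_def)
  fix w assume "u \<approx> w"
  then have "u @ v \<approx> w @ v" using assms word_equiv_appendR by (auto simp: reduced_def)
  then show "length u \<le> length w" using assms by (auto simp: reduced_def)
qed

text \<open>
  The rank-two case carried along by a prefix \<open>p\<close>. Up to length \<open>m s t - 1\<close> the coefficients involve
  Chebyshev numbers of index at most \<open>m s t\<close>, that is, values of \<open>sin\<close> on angles up to \<open>\<pi>\<close>.
\<close>

lemma alternating_root_in_cone: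
  assumes st: "s \<in> S" "t \<in> S" "s \<noteq> t" and n: "\<And>k. m s t = enat k \<Longrightarrow> n < k"
    and pos: "act p (\<alpha> s) \<in> root_cone" "act p (\<alpha> t) \<in> root_cone"
  shows "act (p @ alternating s t n) (\<alpha> s) \<in> root_cone"
proof -
  obtain x \<kappa> where \<kappa>: "0 < \<kappa>" "B (\<alpha> s) (\<beta> t) = - (\<kappa> * x)" "B (\<alpha> t) (\<beta> s) = - (x / \<kappa>)"
    and x: "\<And>k. m s t = enat k \<Longrightarrow> x = cos (pi / real k)" "m s t = \<infinity> \<Longrightarrow> 1 \<le> x"
    using rank_two_parameters[OF st] by metis
  have nonneg: "0 \<le> cheb x i" if "i \<le> Suc n" for i
  proof (cases "m s t")
    case (enat k)
    have "2 \<le> k" using m_off_diag[OF st] enat by (simp add: numeral_eq_enat)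
    then show ?thesis using x(1)[OF enat] n[OF enat] that cheb_cos_nonneg[of k i] by simp
  next
    case infinity
    then show ?thesis using x(2) cheb_nonneg_ge_1 by simp
  qed
  obtain c d where cd: "0 \<le> c" "0 \<le> d" "act (alternating s t n) (\<alpha> s) = c *\<^sub>R \<alpha> s + d *\<^sub>R \<alpha> t"
  proof (cases "even n")
    case True
    show ?thesis
      using that[of "cheb x (Suc n)" "\<kappa> * cheb x n"] True nonneg[of n] nonneg[of "Suc n"]
        act_alternating[OF st(1,2) _ \<kappa>(2,3), of n] \<kappa>(1) by simp
  next
    case False
    show ?thesis
      using that[of "cheb x n" "\<kappa> * cheb x (Suc n)"] False nonneg[of n] nonneg[of "Suc n"]
        act_alternating[OF st(1,2) _ \<kappa>(2,3), of n] \<kappa>(1) by simp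
  qed
  have "act (p @ alternating s t n) (\<alpha> s) = c *\<^sub>R act p (\<alpha> s) + d *\<^sub>R act p (\<alpha> t)"
    by (simp add: cd(3) linear_add[OF linear_act] linear_scale[OF linear_act])
  then show ?thesis using root_cone_add root_cone_scale pos cd(1,2) by simp
qed

text \<open>
  The last hypothesis says that the element of \<open>u @ [s]\<close> is not shorter than that of \<open>u\<close>.
  Each step below turns a failure of its claim into a word for \<open>u\<close> or for \<open>u @ [s]\<close> that is too short,
  or into a factorisation with a shorter prefix.
\<close>

lemma act_root_positive:
  assumes "reduced u" "s \<in> S" "\<And>v. u @ [s] \<approx> v \<Longrightarrow> length u \<le> length v"
  shows "act u (\<alpha> s) \<in> root_cone"
  using assms
proof (induction "length u" arbitrary: u s rule: less_induct)
  case less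
  note u = \<open>reduced u\<close> and s = \<open>s \<in> S\<close>
  have uS: "u \<in> lists S" using u by (simp add: reduced_def)
  show ?case
  proof (cases u rule: rev_exhaust)
    case Nil
    then show ?thesis using s root_in_cone by simp
  next
    case (snoc u' t)
    have t: "t \<in> S" and u': "u' \<in> lists S" using snoc uS by auto
    have st: "s \<noteq> t"
    proof
      assume "s = t"
      then have "u @ [s] \<approx> u'" using snoc word_equiv_square[of s u' "[]"] s u' by simp
      then show False using less.prems(3) snoc by fastforce
    qed
    \<comment> \<open>Factorisations through the dihedral subgroup of \<open>s\<close> and \<open>t\<close>; the last letter of \<open>u\<close> provides one with a proper prefix.\<close>
    define fact where "fact p q \<longleftrightarrow> p \<in> lists S \<and> q \<in> lists {s, t} \<and> u \<approx> p @ q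
      \<and> length p + length q = length u" for p q
    have f0: "fact u' [t]" using coxeter_cong.refl[OF uS] snoc u' t by (simp add: fact_def)
    then obtain p where p: "\<exists>q. fact p q" and pmin: "\<And>p'. \<exists>q. fact p' q \<Longrightarrow> length p \<le> length p'"
      using ex_has_least_nat[of "\<lambda>p. \<exists>q. fact p q" u' length] by blast
    then obtain q where "fact p q" by blast
    then have pS: "p \<in> lists S" and qst: "q \<in> lists {s, t}" and upq: "u \<approx> p @ q"
      and len: "length p + length q = length u" by (auto simp: fact_def)
    have qS: "q \<in> lists S" using qst s t by auto
    have "length p \<le> length u'" using pmin f0 by blast
    then have shorter: "length p < length u" using snoc by simp
    \<comment> \<open>Neither \<open>s\<close> nor \<open>t\<close> shortens \<open>p\<close>, since that letter could be moved into \<open>q\<close>.\<close>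
    have ext: "length p \<le> length p'" if a: "a \<in> {s, t}" and p': "p @ [a] \<approx> p'" for a p'
    proof (rule ccontr)
      assume less: "\<not> length p \<le> length p'"
      have aS: "a \<in> S" using a s t by auto
      have p'S: "p' \<in> lists S" using word_equiv_in_lists(2)[OF p'] .
      have "p @ q \<approx> p @ a # a # q"
        using coxeter_cong.sym[OF word_equiv_square[OF aS pS qS]] .
      moreover have "p @ a # a # q \<approx> p' @ a # q"
        using word_equiv_appendR[OF p', of "a # q"] aS qS by simp
      ultimately have *: "u \<approx> p' @ a # q" using upq by (blast intro: coxeter_cong.trans)
      then have "length u \<le> length (p' @ a # q)" using reducedD(2)[OF u] by blast
      then have "length p' + length (a # q) = length u" using less len by simp
      then have "fact p' (a # q)" using * p'S a qst by (auto simp: fact_def)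
      then show False using pmin less by blast
    qed
    have "reduced (p @ q)" using reduced_if_equiv[OF u upq] len by simp
    then have pred: "reduced p" by (rule reduced_prefix)
    have pos: "act p (\<alpha> s) \<in> root_cone" "act p (\<alpha> t) \<in> root_cone"
      using less.hyps[OF shorter pred] s t ext by blast+
    have short: "length q \<le> length y" if y: "q @ [s] \<approx> y" for y
    proof -
      have "u @ [s] \<approx> p @ q @ [s]" using word_equiv_appendR[OF upq, of "[s]"] s by simp
      also have "\<dots> \<approx> p @ y" using word_equiv_appendL[OF y pS] .
      finally (coxeter_cong.trans) have "u @ [s] \<approx> p @ y" .
      then show ?thesis using less.prems(3) len by fastforce
    qed
    have qalt: "q = alternating s t (length q)"
    proof (rule eq_alternating[OF qst st])
      show "q \<noteq> x @ a # a # y" for x y a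
      proof
        assume q: "q = x @ a # a # y"
        then have "q \<approx> x @ y" using word_equiv_square[of a x y] qS by simp
        then have "p @ q \<approx> p @ x @ y" using word_equiv_appendL pS by blast
        then have "length u \<le> length (p @ x @ y)"
          using reducedD(2)[OF u] coxeter_cong.trans[OF upq] by blast
        then show False using len q by simp
      qed
      show "q \<noteq> x @ [s]" for x
      proof
        assume q: "q = x @ [s]"
        then have "q @ [s] \<approx> x" using word_equiv_square[of s x "[]"] qS s by simp
        then show False using short q by fastforce
      qed
    qed
    \<comment> \<open>Otherwise the braid relation makes the last \<open>k\<close> letters of \<open>q\<close> end in \<open>s\<close>, which cancels in \<open>q @ [s]\<close>.\<close>
    have "length q < k" if k: "m s t = enat k" for k
    proof (rule ccontr)
      assume "\<not> ?thesis"
      then obtain i where i: "length q = i + k" by (metis add.commute le_Suc_ex not_less)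
      have k2: "2 \<le> k" using m_off_diag[OF s t st] k by (simp add: numeral_eq_enat)
      then obtain k' where k': "k = Suc k'" by (cases k) auto
      define q1 where "q1 = (if even k then alternating s t i else alternating t s i)"
      have q1: "q1 \<in> lists S" "length q1 = i" 
        using alternating_in_lists[OF s t] alternating_in_lists[OF t s] by (simp_all add: q1_def)
      have A: "alternating s t k' \<in> lists S" using alternating_in_lists[OF s t] .
      have "q @ [s] = q1 @ alternating s t k @ [s]"
        using qalt unfolding i alternating_add q1_def by simp
      also have "\<dots> \<approx> q1 @ alternating t s k @ [s]"
        using word_equiv_append[OF braid_relation[OF s t k] q1(1)] s by simp
      also have "q1 @ alternating t s k @ [s] = (q1 @ alternating s t k') @ s # s # []"
        by (simp add: k')
      also have "\<dots> \<approx> (q1 @ alternating s t k') @ []"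
        using word_equiv_square[OF s] q1 A by (metis append_in_lists_conv lists.Nil)
      finally (coxeter_cong.trans) have "q @ [s] \<approx> q1 @ alternating s t k'" by simp
      then show False using short i k' q1(2) by fastforce
    qed
    then have "act (p @ q) (\<alpha> s) \<in> root_cone"
      using alternating_root_in_cone[OF s t st _ pos, of "length q"] qalt by metis
    then show ?thesis using act_respects_word_equiv[OF upq] by simp
  qed
qed

text \<open>
  A nonempty reduced word \<open>w @ [s]\<close> sends \<open>\<alpha> s\<close> to the negative of a vector in the cone, so it does not
  fix \<open>\<alpha> s\<close>.
\<close>

lemma act_faithful:
  assumes "u \<in> lists S" "act u = id"
  shows "u \<approx> []"
proof -
  obtain v where v: "u \<approx> v" "reduced v" using reduced_exists[OF assms(1)] .
  have id: "act v = id" using act_respects_word_equiv[OF v(1)] assms(2) by simp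
  show ?thesis
  proof (cases v rule: rev_exhaust)
    case Nil
    then show ?thesis using v by simp
  next
    case (snoc w s)
    have s: "s \<in> S" using v(2) snoc by (auto simp: reduced_def)
    have "act w (\<alpha> s) \<in> root_cone"
    proof (rule act_root_positive)
      show "reduced w" using v(2) reduced_prefix snoc by blast
      show "s \<in> S" by (rule s)
      show "length w \<le> length x" if "w @ [s] \<approx> x" for x
        using v(2) that snoc by (fastforce simp: reduced_def)
    qed
    moreover have "\<alpha> s = - act w (\<alpha> s)"
      using fun_cong[OF id, of "\<alpha> s"] snoc s by (simp add: reflection_root linear_neg[OF linear_act])
    ultimately show ?thesis using minus_root_notin_cone[OF s] by (metis minus_minus)
  qed
qed

lemma act_eq_iff:
  assumes "u \<in> lists S" "v \<in> lists S"
  shows "act u = act v \<longleftrightarrow> u \<approx> v"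
proof
  assume "act u = act v"
  moreover have "act (v @ rev v) = act []"
    using act_respects_word_equiv word_equiv_rev_cancel(1)[OF assms(2)] by blast
  ultimately have "act (u @ rev v) = id" by (auto simp: fun_eq_iff)
  then have "u @ rev v \<approx> []" using assms by (intro act_faithful) auto
  then show "u \<approx> v" using word_equiv_if_quotient_trivial assms by blast
qed (rule act_respects_word_equiv)

end


section \<open>The linear reflection groups are Coxeter groups\<close>

lemma group_GL: "group (GL :: ('v::real_vector \<Rightarrow> 'v) monoid)"
proof (rule groupI)
  fix f :: "'v \<Rightarrow> 'v" assume "f \<in> carrier GL"
  then have f: "linear f" "bij f" by (auto simp: GL_def)
  have "linear (inv_into UNIV f)"
  proof (rule linearI)
    have eq: "inv_into UNIV f z = y" if "f y = z" for y z
      using that f(2) by (auto simp: bij_def)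
    show "inv_into UNIV f (x + y) = inv_into UNIV f x + inv_into UNIV f y" for x y
      using f by (intro eq) (simp add: linear_add bij_is_surj surj_f_inv_f)
    show "inv_into UNIV f (c *\<^sub>R x) = c *\<^sub>R inv_into UNIV f x" for c x
      using f by (intro eq) (simp add: linear_scale bij_is_surj surj_f_inv_f)
  qed
  then show "\<exists>g\<in>carrier GL. g \<otimes>\<^bsub>GL\<^esub> f = \<one>\<^bsub>GL\<^esub>"
    using f by (intro bexI[of _ "inv_into UNIV f"]) (auto simp: GL_def bij_imp_bij_inv bij_is_inj)
qed (auto simp: GL_def linear_compose bij_comp linear_id)

lemma (in coxeter_datum) coxeter_system_W1: "coxeter_system (W1 S B \<alpha> \<beta>) S m (\<rho>1 B \<alpha> \<beta>)"
proof -
  interpret GL: group "GL :: ('v \<Rightarrow> 'v) monoid" by (rule group_GL)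
  have "bij (reflection s)" if "s \<in> S" for s
    by (rule o_bij[of "reflection s"]) (auto simp: fun_eq_iff reflection_involution that)
  then have "reflection ` S \<subseteq> carrier GL" by (auto simp: GL_def linear_reflection)
  then have sub: "reflection ` S \<subseteq> carrier (W1 S B \<alpha> \<beta>)"
    unfolding W1_def by (rule GL.subgroup_generated_subset_carrier_subset)
  have "carrier (subgroup_generated (W1 S B \<alpha> \<beta>) (reflection ` S)) = carrier (W1 S B \<alpha> \<beta>)"
    by (simp add: W1_def)
  then have gen: "generate (W1 S B \<alpha> \<beta>) (reflection ` S) = carrier (W1 S B \<alpha> \<beta>)"
    using sub by (simp add: carrier_subgroup_generated Int_absorb1)
  have "word_prod (W1 S B \<alpha> \<beta>) reflection u = act u" for u
    by (induction u) (auto simp: W1_def GL_def)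
  then show ?thesis
    unfolding coxeter_system_def
    using coxeter_parameters_axioms sub gen act_eq_iff by (simp add: W1_def)
qed

text \<open>
  The axioms are symmetric in the two spaces, so results about \<open>W1\<close> transfer to \<open>W2\<close>.
\<close>

lemma (in coxeter_datum) coxeter_datum_dual: "coxeter_datum S m (\<lambda>y x. B x y) \<beta> \<alpha>"
proof unfold_locales
  show "bilinear (\<lambda>y x. B x y)" using bilinear unfolding bilinear_def by blast
  fix s t assume st: "s \<in> S" "t \<in> S"
  show "B (\<alpha> s) (\<beta> s) = 1" using C1[OF st(1)] .
  show "B (\<alpha> t) (\<beta> s) \<le> 0" if "s \<noteq> t" using C2[OF st(2,1)] that by simp
  show "B (\<alpha> t) (\<beta> s) * B (\<alpha> s) (\<beta> t) = (cos (pi / real k))\<^sup>2" if "m s t = enat k" for k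
    using C3_finite[OF st that] by (simp add: mult.commute)
  show "\<exists>\<gamma>\<ge>1. B (\<alpha> t) (\<beta> s) * B (\<alpha> s) (\<beta> t) = \<gamma>\<^sup>2" if "m s t = \<infinity>"
    using C3_infinite[OF st that] by (simp add: mult.commute)
  show "B (\<alpha> t) (\<beta> s) = 0 \<longleftrightarrow> B (\<alpha> s) (\<beta> t) = 0" using C4[OF st(2,1)] .
qed (fact C5_2, fact C5_1)

lemma (in coxeter_datum) coxeter_system_W2: "coxeter_system (W2 S B \<alpha> \<beta>) S m (\<rho>2 B \<alpha> \<beta>)"
proof -
  have "\<rho>1 (\<lambda>y x. B x y) \<beta> \<alpha> = \<rho>2 B \<alpha> \<beta>" by (auto simp: \<rho>1_def \<rho>2_def)
  moreover from this have "W1 S (\<lambda>y x. B x y) \<beta> \<alpha> = W2 S B \<alpha> \<beta>" by (simp add: W1_def W2_def)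
  ultimately show ?thesis using coxeter_datum.coxeter_system_W1[OF coxeter_datum_dual] by simp
qed

lemma coxeter_isomorphicI:
  assumes "f \<in> iso G H" "\<forall>s\<in>S. f (r s) = r' s"
  shows "coxeter_isomorphic G (r ` S) H (r' ` S)"
  unfolding coxeter_isomorphic_def using assms by (intro bexI[of _ f]) (auto simp: image_iff)

theorem theorem2p10:
  fixes S :: "'s set" and m :: "'s \<Rightarrow> 's \<Rightarrow> enat"
    and B :: "'v::real_vector \<Rightarrow> 'w::real_vector \<Rightarrow> real"
    and \<alpha> :: "'s \<Rightarrow> 'v" and \<beta> :: "'s \<Rightarrow> 'w"
    and W :: "('g, 'b) monoid_scheme" and r :: "'s \<Rightarrow> 'g"
  assumes "coxeter_datum S m B \<alpha> \<beta>"
    and "coxeter_system W S m r"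
  shows
    "(\<exists>f1 \<in> hom W (W1 S B \<alpha> \<beta>). \<forall>s\<in>S. f1 (r s) = \<rho>1 B \<alpha> \<beta> s) \<and>
     (\<exists>f2 \<in> hom W (W2 S B \<alpha> \<beta>). \<forall>s\<in>S. f2 (r s) = \<rho>2 B \<alpha> \<beta> s) \<and>
     (\<forall>f1 \<in> hom W (W1 S B \<alpha> \<beta>).
        (\<forall>s\<in>S. f1 (r s) = \<rho>1 B \<alpha> \<beta> s) \<longrightarrow> f1 \<in> iso W (W1 S B \<alpha> \<beta>)) \<and>
     (\<forall>f2 \<in> hom W (W2 S B \<alpha> \<beta>).
        (\<forall>s\<in>S. f2 (r s) = \<rho>2 B \<alpha> \<beta> s) \<longrightarrow> f2 \<in> iso W (W2 S B \<alpha> \<beta>)) \<and>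
     coxeter_system (W1 S B \<alpha> \<beta>) S m (\<rho>1 B \<alpha> \<beta>) \<and>
     coxeter_system (W2 S B \<alpha> \<beta>) S m (\<rho>2 B \<alpha> \<beta>) \<and>
     coxeter_isomorphic W (r ` S) (W1 S B \<alpha> \<beta>) (\<rho>1 B \<alpha> \<beta> ` S) \<and>
     coxeter_isomorphic W (r ` S) (W2 S B \<alpha> \<beta>) (\<rho>2 B \<alpha> \<beta> ` S)"
proof -
  note W1 = coxeter_datum.coxeter_system_W1[OF assms(1)]
    and W2 = coxeter_datum.coxeter_system_W2[OF assms(1)]
  note hom = coxeter_system_hom_exists[OF assms(2) W1] coxeter_system_hom_exists[OF assms(2) W2]
  note iso = coxeter_system_hom_iso[OF assms(2) W1] coxeter_system_hom_iso[OF assms(2) W2]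
  have "coxeter_isomorphic W (r ` S) (W1 S B \<alpha> \<beta>) (\<rho>1 B \<alpha> \<beta> ` S)"
    by (rule bexE[OF hom(1)], rule coxeter_isomorphicI[OF iso(1)])
  moreover have "coxeter_isomorphic W (r ` S) (W2 S B \<alpha> \<beta>) (\<rho>2 B \<alpha> \<beta> ` S)"
    by (rule bexE[OF hom(2)], rule coxeter_isomorphicI[OF iso(2)])
  ultimately show ?thesis
    using W1 W2 hom iso by (intro conjI ballI impI)
qed

end
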